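(* The ensemble average $\langle f\rangle_E(x^k,t)$ of a cosmological fluid field $f$ is a local single-valued function of the reference time $t$ and position $\{x^k\}$, $$\Big(\frac{\partial}{\partial x^{i}}\frac{\partial}{\partial t}-\frac{\partial}{\partial t}\frac{\partial}{\partial x^{i}}\Big)\langle f\rangle_E(x^k,t)=0,\qquad \Big(\frac{\partial}{\partial x^{i}}\frac{\partial}{\partial x^{j}}-\frac{\partial}{\partial x^{j}}\frac{\partial}{\partial x^{i}}\Big)\langle f\rangle_E(x^k,t)=0,$$ and it satisfies the Reynolds conditions: (1* ) the ensemble averaging is a linear operation: $\langle af+bh\rangle_E(x^i,t)=a\langle f\rangle_E(x^i,t)+b\langle h\rangle_E(x^i,t)$ if $a,b=\mathrm{const}$; (2* ) the ensemble averaging commutes with partial differentiation: $$\frac{\partial}{\partial t}\langle f\rangle_E(x^k,t)=\Big\langle\frac{\partial f}{\partial t}\Big\rangle_E(x^k,t),\qquad \frac{\partial}{\partial x^i}\langle f\rangle_E(x^k,t)=\Big\langle\frac{\partial f}{\partial x^i}\Big\rangle_E(x^k,t);$$ (3* ) the ensemble average is idempotent: $$\big\langle\langle f\rangle_E(x^i,t)\,h\big\rangle_E(y^i,s)=\langle f\rangle_E(x^i,t)\,\langle h\rangle_E(y^i,s)\quad\text{or}\quad \langle\langle f\rangle_E\rangle_E(x^i,t)=\langle f\rangle_E(x^i,t).$$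
   Context: $x^i$, $i=1,2,3$, are Cartesian coordinates on three-dimensional Euclidean space $E^3$ and $t,s$ are times. The cosmological fluid fields $f,h$ are random fields: for all times $t$ and positions $\{x^i\}$ of the fluid configuration there is a probability density function $P_{(x^i,t)}(f)$, where $P_{(x^i,t)}(f)\,df$ is the probability that $f(x^i,t)$ takes a value between $f$ and $f+df$ and $\int_{-\infty}^{+\infty}P_{(x^i,t)}(f)\,df=1$. The ensemble average (probability mean) is $$\langle f\rangle_E(x^i,t)=\int_{-\infty}^{+\infty} f\,P_{(x^i,t)}(f)\,df .$$
   Formalization: Regularity is added, since without it the claim fails (e.g. f = X + |x¹|, X normal): realisations of f are twice continuously differentiable in position and time, with first and second partial derivatives locally dominated by an integrable random variable. *)

theory Defs
  imports "HOL-Probability.Probability"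
begin

type_synonym spacetime = "(real^3) \<times> real"

definition has_partial :: "spacetime \<Rightarrow> (spacetime \<Rightarrow> real) \<Rightarrow> spacetime \<Rightarrow> bool" where
  "has_partial b F p \<longleftrightarrow> (\<lambda>r. F (p + r *\<^sub>R b)) field_differentiable (at 0)"

definition partial :: "spacetime \<Rightarrow> (spacetime \<Rightarrow> real) \<Rightarrow> spacetime \<Rightarrow> real" where
  "partial b F p = deriv (\<lambda>r. F (p + r *\<^sub>R b)) 0"

abbreviation d_t :: "(spacetime \<Rightarrow> real) \<Rightarrow> spacetime \<Rightarrow> real" where
  "d_t \<equiv> partial (0, 1)"

abbreviation d_x :: "3 \<Rightarrow> (spacetime \<Rightarrow> real) \<Rightarrow> spacetime \<Rightarrow> real" where
  "d_x i \<equiv> partial (axis i 1, 0)"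

text \<open>The elements of \<^term>\<open>Basis :: spacetime set\<close> are exactly the four coordinate
  directions \<^term>\<open>(axis i 1, 0)\<close> and \<^term>\<open>(0, 1)\<close>.\<close>

definition twice_partially_differentiable_on ::
    "spacetime set \<Rightarrow> (spacetime \<Rightarrow> real) \<Rightarrow> bool" where
  "twice_partially_differentiable_on D F \<longleftrightarrow>
     (\<forall>p\<in>D. \<forall>b\<in>Basis. has_partial b F p \<and> (\<forall>c\<in>Basis. has_partial c (partial b F) p))"

definition C2_on :: "spacetime set \<Rightarrow> (spacetime \<Rightarrow> real) \<Rightarrow> bool" where
  "C2_on D F \<longleftrightarrow>
     twice_partially_differentiable_on D F \<and>
     continuous_on D F \<and>
     (\<forall>b\<in>Basis. continuous_on D (partial b F) \<and>
        (\<forall>c\<in>Basis. continuous_on D (partial c (partial b F))))"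

text \<open>A random field maps an outcome to a realisation of the field on spacetime.
  The one-point law plays the role of \<open>P\<^bsub>(x,t)\<^esub>(f) df\<close>. Working with the law instead of a
  density function gives a meaning to the averages of fields whose one-point distribution has
  no Lebesgue density, such as the deterministic field \<open>\<langle>f\<rangle>\<close> (Dirac law) or \<open>a f + b h\<close>
  with \<open>a = b = 0\<close>.\<close>

definition one_point_law :: "'w measure \<Rightarrow> ('w \<Rightarrow> spacetime \<Rightarrow> real) \<Rightarrow> spacetime \<Rightarrow> real measure" where
  "one_point_law M f p = distr M borel (\<lambda>\<omega>. f \<omega> p)"

definition ensemble_average :: "'w measure \<Rightarrow> ('w \<Rightarrow> spacetime \<Rightarrow> real) \<Rightarrow> spacetime \<Rightarrow> real" where
  "ensemble_average M f p = (\<integral>v. v \<partial>one_point_law M f p)"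

text \<open>Library integrals default to 0 when they do not converge, so existence of the average
  is a separate predicate.\<close>

definition has_ensemble_average :: "'w measure \<Rightarrow> ('w \<Rightarrow> spacetime \<Rightarrow> real) \<Rightarrow> spacetime \<Rightarrow> bool" where
  "has_ensemble_average M f p \<longleftrightarrow>
     (\<lambda>\<omega>. f \<omega> p) \<in> borel_measurable M \<and> integrable (one_point_law M f p) (\<lambda>v. v)"

text \<open>\<open>P p\<close> is the probability density of the value of the field at \<open>p\<close>, with a
  convergent mean. Normalisation of \<open>P p\<close> follows when \<open>M\<close> is a probability space.\<close>

definition fluid_field ::
    "'w measure \<Rightarrow> spacetime set \<Rightarrow> ('w \<Rightarrow> spacetime \<Rightarrow> real) \<Rightarrow> (spacetime \<Rightarrow> real \<Rightarrow> real) \<Rightarrow> bool" where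
  "fluid_field M D f P \<longleftrightarrow>
     (\<forall>p\<in>D. (\<forall>v. 0 \<le> P p v) \<and>
            distributed M lborel (\<lambda>\<omega>. f \<omega> p) (\<lambda>v. ennreal (P p v)) \<and>
            integrable lborel (\<lambda>v. v * P p v))"

text \<open>Smoothness left tacit for a physical field: realisations are twice continuously
  differentiable, and their first and second partial derivatives are locally dominated by an
  integrable random variable. Without some such domination, averages and derivatives need not
  commute.\<close>

definition smooth_field :: "'w measure \<Rightarrow> spacetime set \<Rightarrow> ('w \<Rightarrow> spacetime \<Rightarrow> real) \<Rightarrow> bool" where
  "smooth_field M D f \<longleftrightarrow>
     (\<forall>\<omega>\<in>space M. C2_on D (f \<omega>)) \<and>
     (\<forall>p\<in>D. \<exists>U G. open U \<and> p \<in> U \<and> integrable M (G :: 'w \<Rightarrow> real) \<and>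
        (AE \<omega> in M. \<forall>q\<in>U \<inter> D. \<forall>b\<in>Basis.
           \<bar>partial b (f \<omega>) q\<bar> \<le> G \<omega> \<and>
           (\<forall>c\<in>Basis. \<bar>partial c (partial b (f \<omega>)) q\<bar> \<le> G \<omega>)))"

end

theory Submission
  imports Defs
begin

text \<open>Difference quotients of the realisations are, by the mean value theorem, dominated by the
  integrable bound on the partial derivatives, so dominated convergence moves each partial
  derivative inside the average; the argument applies to the field and again to its first partial
  derivatives. Mixed partial derivatives of the average then commute because those of every
  realisation do.\<close>

section \<open>Partial derivatives as derivatives along lines\<close>

text \<open>\<open>partial\<close> only speaks of parameter 0; moving the base point along the line
  turns this into a derivative at any parameter \<open>r\<close>, the form that the mean value
  theorem consumes.\<close>

lemma has_partial_DERIV: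
  assumes "has_partial b F (p + r *\<^sub>R b)"
  shows "((\<lambda>r. F (p + r *\<^sub>R b)) has_real_derivative partial b F (p + r *\<^sub>R b)) (at r)"
proof -
  have "((\<lambda>k. F (p + r *\<^sub>R b + k *\<^sub>R b)) has_real_derivative partial b F (p + r *\<^sub>R b)) (at 0)"
    using assms unfolding has_partial_def partial_def
    by (simp add: DERIV_deriv_iff_field_differentiable)
  then show ?thesis
    using DERIV_shift[of "\<lambda>r. F (p + r *\<^sub>R b)" "partial b F (p + r *\<^sub>R b)" 0 r]
    by (simp add: algebra_simps)
qed

lemma has_partial_DERIV0:
  assumes "has_partial b F p"
  shows "((\<lambda>r. F (p + r *\<^sub>R b)) has_real_derivative partial b F p) (at 0)"
  using has_partial_DERIV[of b F p 0] assms by simp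

lemma partial_eqI:
  assumes "((\<lambda>r. F (p + r *\<^sub>R b)) has_real_derivative d) (at 0)"
  shows "has_partial b F p" "partial b F p = d"
  using assms unfolding has_partial_def partial_def
  by (auto simp: field_differentiable_def intro: DERIV_imp_deriv)

text \<open>A derivative depends only on values near the point. This lets the average be replaced by
  an expectation although the two are identified only on \<open>D\<close>.\<close>

lemma partial_cong_open:
  assumes "open D" "p \<in> D" "\<And>q. q \<in> D \<Longrightarrow> F q = G q" "has_partial b G p"
  shows "has_partial b F p" "partial b F p = partial b G p"
proof -
  have "open ((\<lambda>r. p + r *\<^sub>R b) -` D)"
    using assms(1) by (intro continuous_open_vimage continuous_intros)
  then have "((\<lambda>r. F (p + r *\<^sub>R b)) has_real_derivative partial b G p) (at 0)"
    by (rule has_field_derivative_transform_within_open[OF has_partial_DERIV0[OF assms(4)]])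
      (use assms in auto)
  then show "has_partial b F p" "partial b F p = partial b G p"
    by (rule partial_eqI)+
qed

lemma partial_mean_value:
  assumes "convex W" "p \<in> W" "p + k *\<^sub>R b \<in> W" "\<And>q. q \<in> W \<Longrightarrow> has_partial b F q"
  shows "\<exists>q\<in>W. F (p + k *\<^sub>R b) - F p = k * partial b F q"
proof -
  \<comment> \<open>Convexity keeps the whole segment between the two endpoints in
    \<open>W\<close>.\<close>
  have W: "p + (\<theta> * k) *\<^sub>R b \<in> W" if "0 \<le> \<theta>" "\<theta> \<le> 1" for \<theta>
  proof -
    have "(1 - \<theta>) *\<^sub>R p + \<theta> *\<^sub>R (p + k *\<^sub>R b) \<in> W"
      using assms(1-3) that by (auto simp: convex_alt)
    then show ?thesis by (simp add: algebra_simps)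
  qed
  \<comment> \<open>The segment is rescaled to [0,1] so that one application of the mean value
    theorem covers every sign of \<open>k\<close>.\<close>
  have "((\<lambda>\<theta>. F (p + (\<theta> * k) *\<^sub>R b)) has_real_derivative
      partial b F (p + (\<theta> * k) *\<^sub>R b) * k) (at \<theta>)" if "0 \<le> \<theta>" "\<theta> \<le> 1" for \<theta>
    by (rule DERIV_chain2[where f = "\<lambda>r. F (p + r *\<^sub>R b)" and g = "\<lambda>\<theta>. \<theta> * k"])
      (auto intro!: has_partial_DERIV assms W that derivative_eq_intros)
  from MVT2[of 0 1, OF _ this] obtain \<theta> where "0 < \<theta>" "\<theta> < 1"
    "F (p + k *\<^sub>R b) - F p = k * partial b F (p + (\<theta> * k) *\<^sub>R b)"
    by (auto simp: mult.commute)
  then show ?thesis using W[of \<theta>] by (intro bexI[of _ "p + (\<theta> * k) *\<^sub>R b"]) auto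
qed

section \<open>Symmetry of second partial derivatives\<close>

text \<open>The mean value theorem is applied twice: along \<open>b\<close> to the difference of
  \<open>F\<close> on two parallel edges of a parallelogram, then along \<open>c\<close> to
  \<open>partial b F\<close>. The second difference on the left is symmetric in \<open>b\<close> and
  \<open>c\<close>, which is what makes it useful.\<close>

lemma second_difference_mean_value:
  assumes "0 < k"
    and "\<And>s r. 0 \<le> s \<Longrightarrow> s \<le> k \<Longrightarrow> 0 \<le> r \<Longrightarrow> r \<le> k \<Longrightarrow>
      has_partial b F (p + s *\<^sub>R b + r *\<^sub>R c) \<and> has_partial c (partial b F) (p + s *\<^sub>R b + r *\<^sub>R c)"
  shows "\<exists>s r. 0 \<le> s \<and> s \<le> k \<and> 0 \<le> r \<and> r \<le> k \<and>
    F (p + k *\<^sub>R b + k *\<^sub>R c) - F (p + k *\<^sub>R b) - F (p + k *\<^sub>R c) + F p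
      = k * k * partial c (partial b F) (p + s *\<^sub>R b + r *\<^sub>R c)"
proof -
  \<comment> \<open>The two edges in direction \<open>b\<close> are those with \<open>r = k\<close>
    and \<open>r = 0\<close>.\<close>
  have "((\<lambda>s. F (p + k *\<^sub>R c + s *\<^sub>R b) - F (p + s *\<^sub>R b)) has_real_derivative
      partial b F (p + k *\<^sub>R c + s *\<^sub>R b) - partial b F (p + s *\<^sub>R b)) (at s)"
    if "0 \<le> s" "s \<le> k" for s
    using assms(2)[OF that, of k] assms(2)[OF that, of 0] assms(1)
    by (intro DERIV_diff has_partial_DERIV) (simp_all add: ac_simps)
  from MVT2[OF assms(1) this] obtain s where s: "0 < s" "s < k"
    "F (p + k *\<^sub>R c + k *\<^sub>R b) - F (p + k *\<^sub>R b) - (F (p + k *\<^sub>R c) - F p)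
      = k * (partial b F (p + k *\<^sub>R c + s *\<^sub>R b) - partial b F (p + s *\<^sub>R b))"
    by auto
  have "((\<lambda>r. partial b F (p + s *\<^sub>R b + r *\<^sub>R c)) has_real_derivative
      partial c (partial b F) (p + s *\<^sub>R b + r *\<^sub>R c)) (at r)" if "0 \<le> r" "r \<le> k" for r
    using assms(2)[of s r] s that by (intro has_partial_DERIV) auto
  from MVT2[OF assms(1) this] obtain r where r: "0 < r" "r < k"
    "partial b F (p + s *\<^sub>R b + k *\<^sub>R c) - partial b F (p + s *\<^sub>R b)
      = k * partial c (partial b F) (p + s *\<^sub>R b + r *\<^sub>R c)"
    by auto
  show ?thesis
    using s r by (intro exI[of _ s] exI[of _ r]) (simp add: ac_simps)
qed

text \<open>Schwarz's theorem: one and the same second difference, divided by \<open>k * k\<close>,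
  is a value of each mixed partial at some point close to \<open>p\<close>; continuity at
  \<open>p\<close> then forces the two to agree there.\<close>

lemma partial_commute:
  assumes "open D" "p \<in> D" "C2_on D F" "b \<in> Basis" "c \<in> Basis"
  shows "partial c (partial b F) p = partial b (partial c F) p"
proof -
  let ?A = "partial c (partial b F)" and ?B = "partial b (partial c F)"
  have diff: "has_partial b' F q" "has_partial c' (partial b' F) q"
    if "q \<in> D" "b' \<in> Basis" "c' \<in> Basis" for q b' c'
    using assms(3) that unfolding C2_on_def twice_partially_differentiable_on_def by auto
  have "isCont ?A p" "isCont ?B p"
    using assms unfolding C2_on_def by (auto simp: continuous_on_eq_continuous_at)
  have "\<bar>?A p - ?B p\<bar> \<le> \<epsilon>" if "\<epsilon> > 0" for \<epsilon>
  proof -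
    obtain d1 where d1: "d1 > 0" "\<And>q. dist q p < d1 \<Longrightarrow> \<bar>?A q - ?A p\<bar> < \<epsilon> / 2"
      using \<open>isCont ?A p\<close> \<open>\<epsilon> > 0\<close> unfolding continuous_at_eps_delta dist_real_def
      by (meson half_gt_zero)
    obtain d2 where d2: "d2 > 0" "\<And>q. dist q p < d2 \<Longrightarrow> \<bar>?B q - ?B p\<bar> < \<epsilon> / 2"
      using \<open>isCont ?B p\<close> \<open>\<epsilon> > 0\<close> unfolding continuous_at_eps_delta dist_real_def
      by (meson half_gt_zero)
    obtain d3 where d3: "d3 > 0" "\<And>q. dist q p < d3 \<Longrightarrow> q \<in> D"
      using assms(1,2) unfolding open_dist by blast
    define d where "d = min d1 (min d2 d3)"
    \<comment> \<open>A third suffices because points of the parallelogram lie within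
      \<open>s + r \<le> 2 * k < d\<close> of \<open>p\<close>.\<close>
    define k where "k = d / 3"
    have "k > 0" using d1 d2 d3 by (simp add: k_def d_def)
    have near: "dist (p + s *\<^sub>R b + r *\<^sub>R c) p < d"
      if "0 \<le> s" "s \<le> k" "0 \<le> r" "r \<le> k" for s r
    proof -
      have "dist (p + s *\<^sub>R b + r *\<^sub>R c) p = norm (s *\<^sub>R b + r *\<^sub>R c)"
        by (simp add: dist_norm algebra_simps)
      also have "\<dots> \<le> s + r"
        using norm_triangle_ineq[of "s *\<^sub>R b" "r *\<^sub>R c"] assms that by simp
      also have "\<dots> < d" using that \<open>k > 0\<close> by (simp add: k_def)
      finally show ?thesis .
    qed
    have inD: "p + s *\<^sub>R b + r *\<^sub>R c \<in> D"
      if "0 \<le> s" "s \<le> k" "0 \<le> r" "r \<le> k" for s r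
      using near[OF that] d3 by (simp add: d_def)
    obtain s r where sr: "0 \<le> s" "s \<le> k" "0 \<le> r" "r \<le> k"
      "F (p + k *\<^sub>R b + k *\<^sub>R c) - F (p + k *\<^sub>R b) - F (p + k *\<^sub>R c) + F p
        = k * k * ?A (p + s *\<^sub>R b + r *\<^sub>R c)"
      using second_difference_mean_value[OF \<open>k > 0\<close>, of b F p c] inD diff assms(4,5) by meson
    \<comment> \<open>The same lemma with \<open>b\<close> and \<open>c\<close> exchanged; its
      second difference is the previous one up to reordering.\<close>
    have "\<exists>r s. 0 \<le> r \<and> r \<le> k \<and> 0 \<le> s \<and> s \<le> k \<and>
      F (p + k *\<^sub>R c + k *\<^sub>R b) - F (p + k *\<^sub>R c) - F (p + k *\<^sub>R b) + F p
        = k * k * ?B (p + r *\<^sub>R c + s *\<^sub>R b)"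
      using inD diff assms(4,5)
      by (intro second_difference_mean_value[OF \<open>k > 0\<close>]) (simp add: add.assoc add.commute[of "_ *\<^sub>R c"])
    then obtain s' r' where sr': "0 \<le> s'" "s' \<le> k" "0 \<le> r'" "r' \<le> k"
      "F (p + k *\<^sub>R b + k *\<^sub>R c) - F (p + k *\<^sub>R b) - F (p + k *\<^sub>R c) + F p
        = k * k * ?B (p + s' *\<^sub>R b + r' *\<^sub>R c)"
      by (auto simp: algebra_simps)
    have "?A (p + s *\<^sub>R b + r *\<^sub>R c) = ?B (p + s' *\<^sub>R b + r' *\<^sub>R c)"
      using sr(5) sr'(5) \<open>k > 0\<close> by simp
    moreover have "\<bar>?A (p + s *\<^sub>R b + r *\<^sub>R c) - ?A p\<bar> < \<epsilon> / 2"
      using near[OF sr(1-4)] by (intro d1) (simp add: d_def)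
    moreover have "\<bar>?B (p + s' *\<^sub>R b + r' *\<^sub>R c) - ?B p\<bar> < \<epsilon> / 2"
      using near[OF sr'(1-4)] by (intro d2) (simp add: d_def)
    ultimately show ?thesis by linarith
  qed
  then have "\<bar>?A p - ?B p\<bar> \<le> 0" by (rule field_le_epsilon) simp
  then show ?thesis by simp
qed

section \<open>Differentiation under the integral sign\<close>

text \<open>Stated for a general family \<open>F\<close> because it serves twice, for the
  realisations and for their first partials. Integrability of the derivative is part of the
  conclusion since the second use takes it as its hypothesis \<open>int\<close>.\<close>

lemma partial_integral:
  fixes F :: "'w \<Rightarrow> spacetime \<Rightarrow> real"
  assumes D: "open D" "p \<in> D"
    and int: "\<And>q. q \<in> D \<Longrightarrow> integrable M (\<lambda>\<omega>. F \<omega> q)"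
    and diff: "\<And>\<omega> q. \<omega> \<in> space M \<Longrightarrow> q \<in> D \<Longrightarrow> has_partial b (F \<omega>) q"
    and U: "open U" "p \<in> U"
    and G: "integrable M G" "AE \<omega> in M. \<forall>q\<in>U \<inter> D. \<bar>partial b (F \<omega>) q\<bar> \<le> G \<omega>"
  shows "integrable M (\<lambda>\<omega>. partial b (F \<omega>) p)"
    and "((\<lambda>r. \<integral>\<omega>. F \<omega> (p + r *\<^sub>R b) \<partial>M) has_real_derivative
      (\<integral>\<omega>. partial b (F \<omega>) p \<partial>M)) (at 0)"
proof -
  \<comment> \<open>A ball is convex, as the mean value theorem requires; inside \<open>U\<close>
    the bound \<open>G\<close> is available, inside \<open>D\<close> differentiability and
    integrability.\<close>
  obtain e where e: "e > 0" "ball p e \<subseteq> U \<inter> D"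
    using D U by (meson Int_iff open_Int openE)
  define W where "W = ball p e"
  have W: "convex W" "p \<in> W" "W \<subseteq> U" "W \<subseteq> D" using e by (auto simp: W_def)
  have meas: "(\<lambda>\<omega>. F \<omega> q) \<in> borel_measurable M" if "q \<in> D" for q
    using int[OF that] by simp
  \<comment> \<open>Dominated convergence is a statement about sequences, so the limit is first
    taken along an arbitrary nonvanishing null sequence whose points stay in
    \<open>W\<close>.\<close>
  have main: "integrable M (\<lambda>\<omega>. partial b (F \<omega>) p) \<and>
      (\<lambda>n. ((\<integral>\<omega>. F \<omega> (p + X n *\<^sub>R b) \<partial>M) - (\<integral>\<omega>. F \<omega> p \<partial>M)) / X n)
        \<longlonglongrightarrow> (\<integral>\<omega>. partial b (F \<omega>) p \<partial>M)"
    if X: "X \<longlonglongrightarrow> 0" "\<And>n. X n \<noteq> 0" "\<And>n. p + X n *\<^sub>R b \<in> W" for X :: "nat \<Rightarrow> real"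
  proof -
    let ?q = "\<lambda>n \<omega>. (F \<omega> (p + X n *\<^sub>R b) - F \<omega> p) / X n"
    have XD: "p + X n *\<^sub>R b \<in> D" for n using X(3) W by auto
    have lim: "(\<lambda>n. ?q n \<omega>) \<longlonglongrightarrow> partial b (F \<omega>) p" if "\<omega> \<in> space M" for \<omega>
    proof -
      have "((\<lambda>r. (F \<omega> (p + r *\<^sub>R b) - F \<omega> p) / r) \<longlongrightarrow> partial b (F \<omega>) p) (at 0)"
        using has_partial_DERIV0[OF diff[OF that D(2)]] by (simp add: DERIV_def)
      moreover have "filterlim X (at 0) sequentially"
        using X by (simp add: filterlim_at)
      ultimately show ?thesis by (rule filterlim_compose)
    qed
    have meas_q: "?q n \<in> borel_measurable M" for n
      using meas[OF XD] meas[OF D(2)] by simp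
    \<comment> \<open>Measurability of the derivative is not assumed; it comes from being a
      pointwise limit of measurable difference quotients on all of \<open>space M\<close>.\<close>
    have meas_lim: "(\<lambda>\<omega>. partial b (F \<omega>) p) \<in> borel_measurable M"
      by (rule borel_measurable_LIMSEQ_real[OF lim meas_q])
    \<comment> \<open>The intermediate point \<open>q\<close> varies with \<open>\<omega>\<close>;
      this is why the bound must hold, outside one null set, at all points of
      \<open>U \<inter> D\<close> at once.\<close>
    have bound: "AE \<omega> in M. norm (?q n \<omega>) \<le> G \<omega>" for n
      using G(2) AE_space
    proof eventually_elim
      case (elim \<omega>)
      obtain q where "q \<in> W" "F \<omega> (p + X n *\<^sub>R b) - F \<omega> p = X n * partial b (F \<omega>) q"
        using partial_mean_value[OF W(1,2) X(3)] diff elim W by blast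
      then show ?case using elim(1) W X(2)[of n] by auto
    qed
    have "AE \<omega> in M. (\<lambda>n. ?q n \<omega>) \<longlonglongrightarrow> partial b (F \<omega>) p" using lim by simp
    note dc = integrable_dominated_convergence[OF meas_lim meas_q G(1) this bound]
      integral_dominated_convergence[OF meas_lim meas_q G(1) this bound]
    have "integral\<^sup>L M (?q n) = ((\<integral>\<omega>. F \<omega> (p + X n *\<^sub>R b) \<partial>M) - (\<integral>\<omega>. F \<omega> p \<partial>M)) / X n" for n
      using int[OF XD] int[OF D(2)] by simp
    with dc X(2) show ?thesis by simp
  qed
  have ev: "eventually (\<lambda>r. p + r *\<^sub>R b \<in> W) (nhds 0)"
  proof -
    have "((\<lambda>r. p + r *\<^sub>R b) \<longlongrightarrow> p + 0 *\<^sub>R b) (nhds 0)"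
      by (intro tendsto_intros filterlim_ident)
    then show ?thesis
      by (rule topological_tendstoD) (auto simp: W_def e)
  qed
  \<comment> \<open>A null sequence may begin outside \<open>W\<close>; dropping finitely many terms
    repairs this without changing limits.\<close>
  have shifted: "\<exists>N. \<forall>n. p + X (n + N) *\<^sub>R b \<in> W" if "X \<longlonglongrightarrow> 0" for X :: "nat \<Rightarrow> real"
    using filterlim_iff[THEN iffD1, OF that, rule_format, OF ev]
    by (auto simp: eventually_sequentially) (metis le_add2)
  show "integrable M (\<lambda>\<omega>. partial b (F \<omega>) p)"
  proof -
    \<comment> \<open>For integrability any one nonvanishing null sequence will do.\<close>
    let ?X = "\<lambda>n. inverse (real (Suc n))"
    obtain N where N: "\<And>n. p + ?X (n + N) *\<^sub>R b \<in> W"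
      using shifted[OF LIMSEQ_inverse_real_of_nat] by blast
    show ?thesis
      by (rule main[THEN conjunct1, of "\<lambda>n. ?X (n + N)"])
        (use N LIMSEQ_ignore_initial_segment[OF LIMSEQ_inverse_real_of_nat, of N] in auto)
  qed
  show "((\<lambda>r. \<integral>\<omega>. F \<omega> (p + r *\<^sub>R b) \<partial>M) has_real_derivative
      (\<integral>\<omega>. partial b (F \<omega>) p \<partial>M)) (at 0)"
    \<comment> \<open>Sequential characterisation of the limit of the difference quotient.\<close>
    unfolding DERIV_def tendsto_at_iff_sequentially
  proof (intro allI impI)
    fix X :: "nat \<Rightarrow> real"
    assume X: "\<forall>i. X i \<in> UNIV - {0}" "X \<longlonglongrightarrow> 0"
    obtain N where "\<And>n. p + X (n + N) *\<^sub>R b \<in> W" using shifted[OF X(2)] by blast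
    then have "(\<lambda>n. ((\<integral>\<omega>. F \<omega> (p + X (n + N) *\<^sub>R b) \<partial>M) - (\<integral>\<omega>. F \<omega> p \<partial>M)) / X (n + N))
        \<longlonglongrightarrow> (\<integral>\<omega>. partial b (F \<omega>) p \<partial>M)"
      using X by (intro main[THEN conjunct2] LIMSEQ_ignore_initial_segment) auto
    then show "((\<lambda>h. ((\<integral>\<omega>. F \<omega> (p + (0 + h) *\<^sub>R b) \<partial>M) - (\<integral>\<omega>. F \<omega> (p + 0 *\<^sub>R b) \<partial>M)) / h) \<circ> X)
        \<longlonglongrightarrow> (\<integral>\<omega>. partial b (F \<omega>) p \<partial>M)"
      by - (rule LIMSEQ_offset[where k = N], simp add: o_def)
  qed
qed

section \<open>Ensemble averages as expectations\<close>

text \<open>Change of variables for the image measure: the mean of the one-point law is an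
  expectation over outcomes, to which the integral theorems on \<open>M\<close> apply.\<close>

lemma ensemble_average_integrable:
  assumes "integrable M (\<lambda>\<omega>. f \<omega> p)"
  shows "has_ensemble_average M f p" "ensemble_average M f p = (\<integral>\<omega>. f \<omega> p \<partial>M)"
proof -
  have [measurable]: "(\<lambda>\<omega>. f \<omega> p) \<in> borel_measurable M" using assms by simp
  show "has_ensemble_average M f p"
    using assms by (simp add: has_ensemble_average_def one_point_law_def integrable_distr_eq)
  show "ensemble_average M f p = (\<integral>\<omega>. f \<omega> p \<partial>M)"
    by (simp add: ensemble_average_def one_point_law_def integral_distr)
qed

text \<open>Transfer from density to outcomes; nonnegativity of \<open>P p\<close> lets the
  \<open>ennreal\<close>-valued density be read as a real one.\<close>

lemma fluid_field_integrable:
  assumes "fluid_field M D f P" "p \<in> D"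
  shows "integrable M (\<lambda>\<omega>. f \<omega> p)" "(\<integral>\<omega>. f \<omega> p \<partial>M) = (\<integral>v. v * P p v \<partial>lborel)"
proof -
  have *: "\<And>v. 0 \<le> P p v" "distributed M lborel (\<lambda>\<omega>. f \<omega> p) (\<lambda>v. ennreal (P p v))"
    "integrable lborel (\<lambda>v. v * P p v)"
    using assms by (auto simp: fluid_field_def)
  show "integrable M (\<lambda>\<omega>. f \<omega> p)"
    using distributed_integrable[OF *(2), of "\<lambda>v. v"] * by (simp add: mult.commute)
  show "(\<integral>\<omega>. f \<omega> p \<partial>M) = (\<integral>v. v * P p v \<partial>lborel)"
    using distributed_integral[OF *(2), of "\<lambda>v. v"] * by (simp add: mult.commute)
qed

section \<open>Derivatives of the ensemble average\<close>

lemma ensemble_average_partial: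
  assumes "open D" "p \<in> D" "b \<in> Basis" "smooth_field M D f"
    and "\<And>q. q \<in> D \<Longrightarrow> integrable M (\<lambda>\<omega>. f \<omega> q)"
  shows "has_partial b (ensemble_average M f) p"
    and "partial b (ensemble_average M f) p = (\<integral>\<omega>. partial b (f \<omega>) p \<partial>M)"
    and "integrable M (\<lambda>\<omega>. partial b (f \<omega>) p)"
proof -
  obtain U G where U: "open U" "p \<in> U" and G: "integrable M (G :: _ \<Rightarrow> real)" and
    bd: "AE \<omega> in M. \<forall>q\<in>U \<inter> D. \<forall>b\<in>Basis. \<bar>partial b (f \<omega>) q\<bar> \<le> G \<omega> \<and>
           (\<forall>c\<in>Basis. \<bar>partial c (partial b (f \<omega>)) q\<bar> \<le> G \<omega>)"
    using assms(2,4) unfolding smooth_field_def by blast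
  have bd_b: "AE \<omega> in M. \<forall>q\<in>U \<inter> D. \<bar>partial b (f \<omega>) q\<bar> \<le> G \<omega>"
    using bd by eventually_elim (use assms(3) in blast)
  have diff: "has_partial b (f \<omega>) q" if "\<omega> \<in> space M" "q \<in> D" for \<omega> q
    using assms(3,4) that
    unfolding smooth_field_def C2_on_def twice_partially_differentiable_on_def by blast
  note d = partial_integral[where F = f, OF assms(1,2,5) diff U G bd_b]
  show "integrable M (\<lambda>\<omega>. partial b (f \<omega>) p)" by (rule d(1))
  note d' = partial_eqI[where F = "\<lambda>q. \<integral>\<omega>. f \<omega> q \<partial>M" and p = p, OF d(2)]
  show "has_partial b (ensemble_average M f) p"
    "partial b (ensemble_average M f) p = (\<integral>\<omega>. partial b (f \<omega>) p \<partial>M)"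
    \<comment> \<open>The derivative found for the expectation passes to the average, which
      coincides with it on the open set \<open>D\<close>.\<close>
    using partial_cong_open[where F = "ensemble_average M f"
        and G = "\<lambda>q. \<integral>\<omega>. f \<omega> q \<partial>M", OF assms(1,2) _ d'(1)]
      ensemble_average_integrable(2)[where f = f] assms(5) d'(2)
    by simp_all
qed

text \<open>The first-order formula holds throughout \<open>D\<close>, so the first partial of the
  average is again an expectation there and can be differentiated under the integral once
  more.\<close>

lemma ensemble_average_partial_partial:
  assumes "open D" "p \<in> D" "b \<in> Basis" "c \<in> Basis" "smooth_field M D f"
    and "\<And>q. q \<in> D \<Longrightarrow> integrable M (\<lambda>\<omega>. f \<omega> q)"
  shows "has_partial c (partial b (ensemble_average M f)) p"
    and "partial c (partial b (ensemble_average M f)) p = (\<integral>\<omega>. partial c (partial b (f \<omega>)) p \<partial>M)"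
proof -
  note first = ensemble_average_partial[OF assms(1) _ assms(3,5,6)]
  obtain U G where U: "open U" "p \<in> U" and G: "integrable M (G :: _ \<Rightarrow> real)" and
    bd: "AE \<omega> in M. \<forall>q\<in>U \<inter> D. \<forall>b\<in>Basis. \<bar>partial b (f \<omega>) q\<bar> \<le> G \<omega> \<and>
           (\<forall>c\<in>Basis. \<bar>partial c (partial b (f \<omega>)) q\<bar> \<le> G \<omega>)"
    using assms(2,5) unfolding smooth_field_def by blast
  have bd_bc: "AE \<omega> in M. \<forall>q\<in>U \<inter> D. \<bar>partial c (partial b (f \<omega>)) q\<bar> \<le> G \<omega>"
    using bd by eventually_elim (use assms(3,4) in blast)
  have diff: "has_partial c (partial b (f \<omega>)) q" if "\<omega> \<in> space M" "q \<in> D" for \<omega> q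
    using assms(3-5) that
    unfolding smooth_field_def C2_on_def twice_partially_differentiable_on_def by blast
  note d = partial_integral(2)[where F = "\<lambda>\<omega>. partial b (f \<omega>)",
      OF assms(1,2) first(3) diff U G bd_bc]
  note d' = partial_eqI[where F = "\<lambda>q. \<integral>\<omega>. partial b (f \<omega>) q \<partial>M" and p = p, OF d]
  show "has_partial c (partial b (ensemble_average M f)) p"
    "partial c (partial b (ensemble_average M f)) p = (\<integral>\<omega>. partial c (partial b (f \<omega>)) p \<partial>M)"
    using partial_cong_open[where F = "partial b (ensemble_average M f)"
        and G = "\<lambda>q. \<integral>\<omega>. partial b (f \<omega>) q \<partial>M", OF assms(1,2) _ d'(1)]
      first(2) d'(2)
    by simp_all
qed

text \<open>Symmetry is inherited from the realisations under the integral, so continuity of the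
  second partials of the average never has to be established.\<close>

lemma ensemble_average_partial_commute:
  assumes "open D" "p \<in> D" "b \<in> Basis" "c \<in> Basis" "smooth_field M D f"
    and "\<And>q. q \<in> D \<Longrightarrow> integrable M (\<lambda>\<omega>. f \<omega> q)"
  shows "partial c (partial b (ensemble_average M f)) p = partial b (partial c (ensemble_average M f)) p"
proof -
  have "(\<integral>\<omega>. partial c (partial b (f \<omega>)) p \<partial>M) = (\<integral>\<omega>. partial b (partial c (f \<omega>)) p \<partial>M)"
    using assms by (intro Bochner_Integration.integral_cong partial_commute[of D])
      (auto simp: smooth_field_def)
  then show ?thesis
    using ensemble_average_partial_partial(2)[OF assms(1,2) _ _ assms(5,6)] assms(3,4) by simp
qed

section \<open>Compatibility and Reynolds conditions\<close>

theorem corollary7: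
  fixes M :: "'w measure"
    and D :: "spacetime set"
    and f h :: "'w \<Rightarrow> spacetime \<Rightarrow> real"
    and P Q :: "spacetime \<Rightarrow> real \<Rightarrow> real"
  assumes "prob_space M"
    and "open D"
    and "fluid_field M D f P"
    and "fluid_field M D h Q"
    and "smooth_field M D f"
  shows
    "(\<forall>x t. (x, t) \<in> D \<longrightarrow>
        ensemble_average M f (x, t) = (\<integral>v. v * P (x, t) v \<partial>lborel))
     \<and> twice_partially_differentiable_on D (ensemble_average M f)
     \<and> (\<forall>i x t. (x, t) \<in> D \<longrightarrow>
          d_x i (d_t (ensemble_average M f)) (x, t)
            - d_t (d_x i (ensemble_average M f)) (x, t) = 0)
     \<and> (\<forall>i j x t. (x, t) \<in> D \<longrightarrow>
          d_x i (d_x j (ensemble_average M f)) (x, t)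
            - d_x j (d_x i (ensemble_average M f)) (x, t) = 0)
     \<and> (\<forall>a b x t. (x, t) \<in> D \<longrightarrow>
          has_ensemble_average M (\<lambda>\<omega> p. a * f \<omega> p + b * h \<omega> p) (x, t) \<and>
          ensemble_average M (\<lambda>\<omega> p. a * f \<omega> p + b * h \<omega> p) (x, t)
            = a * ensemble_average M f (x, t) + b * ensemble_average M h (x, t))
     \<and> (\<forall>x t. (x, t) \<in> D \<longrightarrow>
          has_ensemble_average M (\<lambda>\<omega>. d_t (f \<omega>)) (x, t) \<and>
          d_t (ensemble_average M f) (x, t) = ensemble_average M (\<lambda>\<omega>. d_t (f \<omega>)) (x, t))
     \<and> (\<forall>i x t. (x, t) \<in> D \<longrightarrow>
          has_ensemble_average M (\<lambda>\<omega>. d_x i (f \<omega>)) (x, t) \<and>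
          d_x i (ensemble_average M f) (x, t) = ensemble_average M (\<lambda>\<omega>. d_x i (f \<omega>)) (x, t))
     \<and> (\<forall>x t y s. (x, t) \<in> D \<longrightarrow> (y, s) \<in> D \<longrightarrow>
          has_ensemble_average M (\<lambda>\<omega> p. ensemble_average M f (x, t) * h \<omega> p) (y, s) \<and>
          ensemble_average M (\<lambda>\<omega> p. ensemble_average M f (x, t) * h \<omega> p) (y, s)
            = ensemble_average M f (x, t) * ensemble_average M h (y, s))
     \<and> (\<forall>x t. (x, t) \<in> D \<longrightarrow>
          has_ensemble_average M (\<lambda>\<omega>. ensemble_average M f) (x, t) \<and>
          ensemble_average M (\<lambda>\<omega>. ensemble_average M f) (x, t) = ensemble_average M f (x, t))"
proof -
  interpret prob_space M by fact
  note f_int = fluid_field_integrable[OF assms(3)]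
  note h_int = fluid_field_integrable[OF assms(4)]
  note avg = ensemble_average_integrable
  note first = ensemble_average_partial[OF assms(2) _ _ assms(5) f_int(1)]
  note second = ensemble_average_partial_partial[OF assms(2) _ _ _ assms(5) f_int(1)]
  note commute = ensemble_average_partial_commute[OF assms(2) _ _ _ assms(5) f_int(1)]
  have Basis_t: "(0, 1) \<in> (Basis :: spacetime set)"
    by (simp add: Basis_prod_def)
  have Basis_x: "(axis i 1, 0) \<in> (Basis :: spacetime set)" for i
    by (auto simp: Basis_prod_def Basis_vec_def)
  have der: "has_ensemble_average M (\<lambda>\<omega>. partial b (f \<omega>)) p \<and>
      partial b (ensemble_average M f) p = ensemble_average M (\<lambda>\<omega>. partial b (f \<omega>)) p"
    if "p \<in> D" "b \<in> Basis" for p b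
    using first[OF that] avg[of M "\<lambda>\<omega>. partial b (f \<omega>)" p] by simp
  have lin: "has_ensemble_average M (\<lambda>\<omega> p. a * f \<omega> p + b * h \<omega> p) p \<and>
      ensemble_average M (\<lambda>\<omega> p. a * f \<omega> p + b * h \<omega> p) p
        = a * ensemble_average M f p + b * ensemble_average M h p" if "p \<in> D" for a b p
    using avg[of M "\<lambda>\<omega> p. a * f \<omega> p + b * h \<omega> p" p] avg[of M f p] avg[of M h p]
      f_int[OF that] h_int[OF that] by simp
  \<comment> \<open>For idempotence: the average at a fixed \<open>(x, t)\<close> is a plain number,
    so it factors out as the coefficient \<open>a\<close>.\<close>
  have scale: "has_ensemble_average M (\<lambda>\<omega> p. a * h \<omega> p) p \<and>
      ensemble_average M (\<lambda>\<omega> p. a * h \<omega> p) p = a * ensemble_average M h p" if "p \<in> D" for a p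
    using lin[OF that, of 0 a] by simp
  \<comment> \<open>A deterministic field is its own average because \<open>M\<close> has total mass
    1; with \<open>g\<close> the average itself this is the second form of idempotence.\<close>
  have const: "has_ensemble_average M (\<lambda>\<omega>. g) p \<and> ensemble_average M (\<lambda>\<omega>. g) p = g p" for g p
    using avg[of M "\<lambda>\<omega>. g" p] by (simp add: prob_space)
  have twice: "twice_partially_differentiable_on D (ensemble_average M f)"
    using first(1) second(1) unfolding twice_partially_differentiable_on_def by blast
  show ?thesis
  proof (intro conjI)
    show "\<forall>x t. (x, t) \<in> D \<longrightarrow>
        ensemble_average M f (x, t) = (\<integral>v. v * P (x, t) v \<partial>lborel)"
      using avg(2)[of M f, OF f_int(1)] f_int(2) by metis
    show "\<forall>i x t. (x, t) \<in> D \<longrightarrow>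
        d_x i (d_t (ensemble_average M f)) (x, t) - d_t (d_x i (ensemble_average M f)) (x, t) = 0"
      using commute[OF _ Basis_t Basis_x] by (metis diff_self)
    show "\<forall>i j x t. (x, t) \<in> D \<longrightarrow>
        d_x i (d_x j (ensemble_average M f)) (x, t) - d_x j (d_x i (ensemble_average M f)) (x, t) = 0"
      using commute[OF _ Basis_x Basis_x] by (metis diff_self)
  qed (intro allI impI twice lin scale const der Basis_t Basis_x; assumption)+
qed

end
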